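(* Let $R$ be a ring, let $n\geq 3$ be an integer, and let $k$ be a positive integer. If $A\in R_n$ and $\mathrm{Tr}(A)$ is a sum of $k$ commutators in $R$, then $A$ is a sum of $\lfloor\log_2(n)\rfloor+k+2$ nilpotent matrices in $R_n$.
   Context: All rings are unital and associative (not necessarily commutative). $R_n$ is the ring of $n\times n$ matrices over $R$. For $A=(a_{ij})\in R_n$, $\mathrm{Tr}(A)=a_{11}+\dots+a_{nn}\in R$. An element $z\in R$ is a commutator if there exist $x,y\in R$ with $z=xy-yx$. *)

theory Defs
  imports Complex_Main "Jordan_Normal_Form.Matrix"
begin

text \<open>
  A unital associative ring is rendered by the sort \<open>{ring, monoid_mult}\<close> rather than by
  \<open>ring_1\<close>, because \<open>ring_1\<close> additionally demands \<open>0 \<noteq> 1\<close> and so excludes the zero ring.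
  The matrix ring over it is \<open>carrier_mat n n\<close> with the library's sum and product;
  the library's power of a matrix is not used since it is restricted to \<open>semiring_1\<close>.
\<close>

definition commutator :: "'a::{ring,monoid_mult} \<Rightarrow> bool" where
  "commutator z \<longleftrightarrow> (\<exists>x y. z = x * y - y * x)"

definition sum_of_commutators :: "nat \<Rightarrow> 'a::{ring,monoid_mult} \<Rightarrow> bool" where
  "sum_of_commutators k z \<longleftrightarrow>
     (\<exists>cs. length cs = k \<and> (\<forall>c\<in>set cs. commutator c) \<and> z = sum_list cs)"

definition mat_trace :: "'a::comm_monoid_add mat \<Rightarrow> 'a" where
  "mat_trace A = (\<Sum>i<dim_row A. A $$ (i, i))"

primrec mat_power :: "'a::{ring,monoid_mult} mat \<Rightarrow> nat \<Rightarrow> 'a mat" where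
  "mat_power A 0 = 1\<^sub>m (dim_row A)"
| "mat_power A (Suc m) = mat_power A m * A"

definition nilpotent_mat :: "nat \<Rightarrow> 'a::{ring,monoid_mult} mat \<Rightarrow> bool" where
  "nilpotent_mat n A \<longleftrightarrow> A \<in> carrier_mat n n \<and> (\<exists>m. mat_power A m = 0\<^sub>m n n)"

text \<open>
  The type of all matrices has no overall zero, so sums of \<open>n \<times> n\<close> matrices are folded
  from \<open>0\<^sub>m n n\<close>. The zero matrix is nilpotent, so \<open>exactly m\<close> and \<open>at most m\<close> summands
  amount to the same.
\<close>

definition sum_of_nilpotents :: "nat \<Rightarrow> nat \<Rightarrow> 'a::{ring,monoid_mult} mat \<Rightarrow> bool" where
  "sum_of_nilpotents n m A \<longleftrightarrow>
     (\<exists>Ns. length Ns = m \<and> (\<forall>N\<in>set Ns. nilpotent_mat n N) \<and> A = foldr (+) Ns (0\<^sub>m n n))"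

end

theory Submission
  imports Defs
begin

text \<open>
  The commutators in the trace are removed one at a time, each by one nilpotent matrix, and what is
  then left, a matrix of trace zero, is a sum of three nilpotents.

  Both steps use matrices of the form \<open>u v\<close> with \<open>u\<close> a column and \<open>v\<close> a row. Since
  \<open>(u v) (u v) = u (v u) v\<close>, such a matrix has square zero as soon as the scalar \<open>v u\<close> vanishes,
  whereas its trace is the sum of the products \<open>u\<^sub>i v\<^sub>i\<close> taken in the opposite order. Over a
  noncommutative ring the trace need therefore not vanish: the column \<open>(x, 1, 0, \<dots>)\<close> and the row
  \<open>(y, - y x, 0, \<dots>)\<close> give a square-zero matrix of trace \<open>x y - y x\<close>
  (\<open>nilpotent_mat_with_commutator_trace\<close>). Subtracting one such matrix for each commutator leaves
  trace zero.

  If \<open>A\<close> has trace zero and diagonal \<open>d\<close>, take the column \<open>(1, \<dots>, 1)\<close> and the row \<open>d\<close>: the product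
  has square zero and the same diagonal as \<open>A\<close>. The difference has zero diagonal, so it is a strictly
  upper plus a strictly lower triangular matrix
  (\<open>trace_zero_sum_of_three_nilpotents\<close>).

  This gives \<open>k + 3\<close> summands. As \<open>\<lfloor>log 2 n\<rfloor> \<ge> 1\<close>, zero matrices fill up the required number.
\<close>

lemma mat_power_carrier:
  "A \<in> carrier_mat n n \<Longrightarrow> mat_power A m \<in> carrier_mat n n"
  by (induction m) auto

lemma index_mult_mat_sum:
  assumes "A \<in> carrier_mat n n" "B \<in> carrier_mat n n" "i < n" "j < n"
  shows "(A * B) $$ (i, j) = (\<Sum>l<n. A $$ (i, l) * B $$ (l, j))"
  using assms by (auto simp: scalar_prod_def lessThan_atLeast0)

lemma mat_power_one:
  assumes A: "A \<in> carrier_mat n n"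
  shows "mat_power A 1 = A"
proof (rule eq_matI)
  fix i j assume "i < dim_row A" "j < dim_col A"
  hence ij: "i < n" "j < n" using A by auto
  have "mat_power A 1 $$ (i, j) = (\<Sum>l<n. 1\<^sub>m n $$ (i, l) * A $$ (l, j))"
    using A ij index_mult_mat_sum[of "1\<^sub>m n" n A i j] by simp
  also have "\<dots> = (\<Sum>l<n. if l = i then A $$ (i, j) else 0)"
    using ij by (intro sum.cong) auto
  also have "\<dots> = A $$ (i, j)" using ij by simp
  finally show "mat_power A 1 $$ (i, j) = A $$ (i, j)" .
qed (use A in auto)

lemma nilpotent_mat_zero: "nilpotent_mat n (0\<^sub>m n n)"
  unfolding nilpotent_mat_def using mat_power_one[of "0\<^sub>m n n" n] zero_carrier_mat by blast

text \<open>
  A matrix whose entries only go strictly up along a ranking \<open>f\<close> of the indices is strictly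
  triangular after reordering. Its \<open>m\<close>-th power is supported on pairs whose ranks differ by at
  least \<open>m\<close>, and the ranks are bounded. Arbitrary rankings cover the upper and the lower triangular
  case together; transposition would not, since it does not reverse products over a
  noncommutative ring.
\<close>

lemma nilpotent_mat_of_ranking:
  fixes f :: "nat \<Rightarrow> nat"
  assumes A: "A \<in> carrier_mat n n"
    and up: "\<And>i j. i < n \<Longrightarrow> j < n \<Longrightarrow> \<not> f i < f j \<Longrightarrow> A $$ (i, j) = 0"
    and bound: "\<And>i. i < n \<Longrightarrow> f i \<le> b"
  shows "nilpotent_mat n A"
proof -
  have support: "mat_power A m $$ (i, j) = 0" if "i < n" "j < n" "f j < f i + m" for m i j
    using that
  proof (induction m arbitrary: j)
    case 0
    then show ?case using A by auto
  next
    case (Suc m)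
    have "mat_power A m $$ (i, l) * A $$ (l, j) = 0" if "l < n" for l
    proof (cases "f l < f j")
      case True
      then show ?thesis using Suc.IH[of l] Suc.prems that by simp
    next
      case False
      then show ?thesis using up[of l j] Suc.prems that by simp
    qed
    then show ?case
      using Suc.prems A index_mult_mat_sum[OF mat_power_carrier[OF A] A] by simp
  qed
  have "mat_power A (Suc b) = 0\<^sub>m n n"
  proof (rule eq_matI)
    fix i j assume "i < dim_row (0\<^sub>m n n :: 'a mat)" "j < dim_col (0\<^sub>m n n :: 'a mat)"
    then show "mat_power A (Suc b) $$ (i, j) = 0\<^sub>m n n $$ (i, j)"
      using support[of i j "Suc b"] bound[of j] by (simp del: mat_power.simps)
  qed (use mat_power_carrier[OF A, of "Suc b"] in auto)
  then show ?thesis using A unfolding nilpotent_mat_def by blast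
qed

definition outer_mat :: "nat \<Rightarrow> (nat \<Rightarrow> 'a) \<Rightarrow> (nat \<Rightarrow> 'a) \<Rightarrow> 'a::{ring,monoid_mult} mat" where
  "outer_mat n u v = mat n n (\<lambda>(i, j). u i * v j)"

lemma outer_mat_carrier [simp]: "outer_mat n u v \<in> carrier_mat n n"
  by (simp add: outer_mat_def)

lemma mat_trace_outer_mat: "mat_trace (outer_mat n u v) = (\<Sum>i<n. u i * v i)"
  by (simp add: mat_trace_def outer_mat_def)

lemma nilpotent_outer_mat:
  assumes vu: "(\<Sum>l<n. v l * u l) = 0"
  shows "nilpotent_mat n (outer_mat n u v)"
proof -
  let ?N = "outer_mat n u v"
  have "?N * ?N = 0\<^sub>m n n"
  proof (rule eq_matI)
    fix i j assume "i < dim_row (0\<^sub>m n n :: 'a mat)" "j < dim_col (0\<^sub>m n n :: 'a mat)"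
    hence ij: "i < n" "j < n" by auto
    have "(?N * ?N) $$ (i, j) = (\<Sum>l<n. u i * (v l * u l) * v j)"
      unfolding index_mult_mat_sum[OF outer_mat_carrier outer_mat_carrier ij]
      using ij by (intro sum.cong) (auto simp: outer_mat_def mult.assoc)
    also have "\<dots> = u i * (\<Sum>l<n. v l * u l) * v j"
      by (simp add: sum_distrib_left sum_distrib_right)
    finally show "(?N * ?N) $$ (i, j) = 0\<^sub>m n n $$ (i, j)" using vu ij by simp
  qed (simp_all add: outer_mat_def)
  moreover have "mat_power ?N (Suc 1) = ?N * ?N"
    unfolding mat_power.simps(2) mat_power_one[OF outer_mat_carrier] ..
  ultimately show ?thesis
    unfolding nilpotent_mat_def using outer_mat_carrier by metis
qed

text \<open>
  With the column \<open>(x, 1)\<close> and the row \<open>(y, - y x)\<close>, the row times the column cancels, while the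
  diagonal of the column times the row is \<open>(x y, - y x)\<close>.
\<close>

lemma nilpotent_mat_with_commutator_trace:
  fixes x y :: "'a::{ring,monoid_mult}"
  assumes "n \<ge> 2"
  obtains N where "nilpotent_mat n N" "mat_trace N = x * y - y * x"
proof -
  define u where "u = (\<lambda>i::nat. if i = 0 then x else if i = 1 then 1 else 0)"
  define v where "v = (\<lambda>i::nat. if i = 0 then y else if i = 1 then - (y * x) else 0)"
  have first_two: "(\<Sum>i<n. g i) = g 0 + g 1" if "\<And>i. i \<ge> 2 \<Longrightarrow> g i = 0" for g :: "nat \<Rightarrow> 'a"
  proof -
    have "(\<Sum>i<n. g i) = (\<Sum>i<2. g i)"
      using assms that by (intro sum.mono_neutral_right) auto
    then show ?thesis by (simp add: numeral_2_eq_2)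
  qed
  have "(\<Sum>l<n. v l * u l) = 0"
    by (subst first_two) (auto simp: u_def v_def)
  moreover have "(\<Sum>l<n. u l * v l) = x * y - y * x"
    by (subst first_two) (auto simp: u_def v_def)
  ultimately show ?thesis
    using that[OF nilpotent_outer_mat] by (simp add: mat_trace_outer_mat)
qed

lemma sum_of_nilpotents_0: "sum_of_nilpotents n 0 (0\<^sub>m n n)"
  by (simp add: sum_of_nilpotents_def)

lemma sum_of_nilpotents_Suc:
  assumes "nilpotent_mat n N" "sum_of_nilpotents n m B"
  shows "sum_of_nilpotents n (Suc m) (N + B)"
proof -
  obtain Ns where "length Ns = m" "\<forall>N\<in>set Ns. nilpotent_mat n N" "B = foldr (+) Ns (0\<^sub>m n n)"
    using assms(2) unfolding sum_of_nilpotents_def by auto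
  then show ?thesis
    unfolding sum_of_nilpotents_def using assms(1) by (intro exI[of _ "N # Ns"]) simp
qed

lemma sum_of_nilpotents_mono:
  assumes "sum_of_nilpotents n m A" "A \<in> carrier_mat n n" "m \<le> m'"
  shows "sum_of_nilpotents n m' A"
  using assms(3)
proof (induction rule: dec_induct)
  case base
  show ?case by (rule assms(1))
next
  case (step m')
  have "sum_of_nilpotents n (Suc m') (0\<^sub>m n n + A)"
    by (rule sum_of_nilpotents_Suc[OF nilpotent_mat_zero step.IH])
  then show ?case using assms(2) by simp
qed

text \<open>
  The diagonal is carried by the matrix all of whose rows equal it; the rest splits into its parts
  above and below the diagonal.
\<close>

lemma trace_zero_sum_of_three_nilpotents:
  assumes A: "A \<in> carrier_mat n n" and tr: "mat_trace A = 0"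
  shows "sum_of_nilpotents n 3 A"
proof -
  define D where "D = outer_mat n (\<lambda>_. 1) (\<lambda>j. A $$ (j, j))"
  define U where "U = mat n n (\<lambda>(i, j). if i < j then A $$ (i, j) - D $$ (i, j) else 0)"
  define L where "L = mat n n (\<lambda>(i, j). if j < i then A $$ (i, j) - D $$ (i, j) else 0)"
  have "nilpotent_mat n D"
    unfolding D_def using tr A by (intro nilpotent_outer_mat) (simp add: mat_trace_def)
  moreover have "nilpotent_mat n U"
    by (rule nilpotent_mat_of_ranking[where f = "\<lambda>i. i" and b = n]) (auto simp: U_def)
  moreover have "nilpotent_mat n L"
    by (rule nilpotent_mat_of_ranking[where f = "\<lambda>i. n - i" and b = n]) (auto simp: L_def)
  ultimately have "sum_of_nilpotents n (Suc (Suc (Suc 0))) (D + (U + (L + 0\<^sub>m n n)))"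
    by (intro sum_of_nilpotents_Suc sum_of_nilpotents_0)
  moreover have "D + (U + (L + 0\<^sub>m n n)) = A"
    using A by (intro eq_matI) (auto simp: D_def U_def L_def outer_mat_def not_less_iff_gr_or_eq)
  ultimately show ?thesis by (simp add: numeral_3_eq_3)
qed

lemma sum_of_commutators_trace_nilpotents:
  assumes n: "n \<ge> 2" and "A \<in> carrier_mat n n" and "sum_of_commutators k (mat_trace A)"
  shows "sum_of_nilpotents n (k + 3) A"
  using assms(2,3)
proof (induction k arbitrary: A)
  case 0
  then show ?case
    using trace_zero_sum_of_three_nilpotents by (auto simp: sum_of_commutators_def)
next
  case (Suc k)
  obtain c cs where cs: "length cs = k" "\<forall>c\<in>set cs. commutator c" "commutator c"
    "mat_trace A = c + sum_list cs"
    using Suc.prems(2) by (auto simp: sum_of_commutators_def length_Suc_conv)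
  obtain x y where "c = x * y - y * x" using cs(3) by (auto simp: commutator_def)
  then obtain N where N: "nilpotent_mat n N" "mat_trace N = c"
    using nilpotent_mat_with_commutator_trace[OF n] by metis
  have carrier: "N \<in> carrier_mat n n" using N(1) by (simp add: nilpotent_mat_def)
  have "mat_trace (A - N) = mat_trace A - mat_trace N"
    using Suc.prems(1) carrier by (simp add: mat_trace_def sum_subtractf)
  then have "mat_trace (A - N) = sum_list cs"
    using cs(4) N(2) by simp
  then have "sum_of_commutators k (mat_trace (A - N))"
    using cs by (auto simp: sum_of_commutators_def)
  then have "sum_of_nilpotents n (k + 3) (A - N)"
    using Suc.IH[OF minus_carrier_mat[OF carrier]] by simp
  from sum_of_nilpotents_Suc[OF N(1) this]
  have "sum_of_nilpotents n (Suc k + 3) (N + (A - N))" by simp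
  moreover have "N + (A - N) = A"
    using Suc.prems(1) carrier by (intro eq_matI) auto
  ultimately show ?case by simp
qed

theorem proposition3p10:
  fixes A :: "'a::{ring,monoid_mult} mat" and n k :: nat
  assumes "n \<ge> 3"
    and "k \<ge> 1"
    and "A \<in> carrier_mat n n"
    and "sum_of_commutators k (mat_trace A)"
  shows "sum_of_nilpotents n (nat \<lfloor>log 2 (real n)\<rfloor> + k + 2) A"
proof (rule sum_of_nilpotents_mono)
  show "sum_of_nilpotents n (k + 3) A"
    using assms by (intro sum_of_commutators_trace_nilpotents) auto
  have "1 \<le> log 2 (real n)"
    using assms(1) by (simp add: le_log_iff)
  then have "1 \<le> \<lfloor>log 2 (real n)\<rfloor>" by simp
  then show "k + 3 \<le> nat \<lfloor>log 2 (real n)\<rfloor> + k + 2" by linarith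
qed (rule assms(3))

end
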